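(* Let $\mathcal{A}$ be a simple pseudoline arrangement in the plane, and let $P$ be a set of points containing exactly one point in each face of $\mathcal{A}$. Let $\mathcal{H}$ be the hypergraph with vertex set $P$ which has, for each pseudoline $\ell$ of $\mathcal{A}$, one hyperedge consisting of the points of $P$ lying on one (arbitrarily chosen) side of $\ell$. Then in every realization of $\mathcal{H}$ by pseudohalfplanes, the arrangement formed by the boundary pseudolines of the pseudohalfplanes is combinatorially equivalent to $\mathcal{A}$.
   Context: A pseudoline arrangement is a finite collection of $x$-monotone bi-infinite simple curves (pseudolines) in the plane such that every two of them intersect in exactly one point, where they cross; it is simple if no three pseudolines pass through a common point. Each pseudoline splits the plane into two unbounded components (its sides); a pseudohalfplane family is obtained from a pseudoline arrangement by choosing one side of each pseudoline. The arrangement is viewed as a plane graph: its vertices are intersection points of pseudolines, its edges are maximal connected parts of pseudolines containing no vertex, and its faces are the maximal connected regions of the plane disjoint from all pseudolines. Two arrangements are (combinatorially) equivalent if there is a one-to-one adjacency-preserving correspondence between their pseudolines, vertices, edges and faces. A realization of $\mathcal{H}$ by pseudohalfplanes consists of an injective placement of the vertices of $\mathcal{H}$ as points in the plane together with a pseudohalfplane family in one-to-one correspondence with the hyperedges of $\mathcal{H}$, such that each pseudohalfplane contains exactly the points of its hyperedge.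
   Formalization: In a realization the placed points are additionally required to lie off the boundary pseudolines; otherwise three concurrent lines with a point at their common intersection realize the hypergraph of a triangle arrangement with sides chosen away from the triangle. *)

theory Defs
  imports "HOL-Analysis.Analysis"
begin

type_synonym point = "real \<times> real"

section \<open>Pseudoline arrangements\<close>

definition curve_graph :: "(real \<Rightarrow> real) \<Rightarrow> point set" where
  "curve_graph f = range (\<lambda>x. (x, f x))"

text \<open>An $x$-monotone bi-infinite simple curve meets every vertical line in exactly one point,
  i.e. it is the graph of a continuous function on the whole real line.\<close>

definition pseudoline :: "point set \<Rightarrow> bool" where
  "pseudoline l \<longleftrightarrow> (\<exists>f. continuous_on UNIV f \<and> l = curve_graph f)"

definition cross_at :: "point set \<Rightarrow> point set \<Rightarrow> point \<Rightarrow> bool" where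
  "cross_at l m p \<longleftrightarrow> p \<in> l \<inter> m \<and>
     (\<exists>f g. l = curve_graph f \<and> m = curve_graph g \<and>
        ((\<forall>\<^sub>F x in at_left (fst p). f x < g x) \<and> (\<forall>\<^sub>F x in at_right (fst p). g x < f x) \<or>
         (\<forall>\<^sub>F x in at_left (fst p). g x < f x) \<and> (\<forall>\<^sub>F x in at_right (fst p). f x < g x)))"

definition pseudoline_arrangement :: "point set set \<Rightarrow> bool" where
  "pseudoline_arrangement L \<longleftrightarrow> finite L \<and> (\<forall>l\<in>L. pseudoline l) \<and>
     (\<forall>l\<in>L. \<forall>m\<in>L. l \<noteq> m \<longrightarrow> (\<exists>p. l \<inter> m = {p} \<and> cross_at l m p))"

definition simple_arrangement :: "point set set \<Rightarrow> bool" where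
  "simple_arrangement L \<longleftrightarrow> pseudoline_arrangement L \<and>
     (\<forall>l\<in>L. \<forall>m\<in>L. \<forall>k\<in>L. l \<noteq> m \<and> l \<noteq> k \<and> m \<noteq> k \<longrightarrow> l \<inter> m \<inter> k = {})"

definition sides :: "point set \<Rightarrow> point set set" where
  "sides l = components (- l)"

text \<open>The family chooses the side \<open>s l\<close> of each pseudoline \<open>l\<close> of the arrangement \<open>L\<close>.\<close>

definition pseudohalfplane_family :: "point set set \<Rightarrow> (point set \<Rightarrow> point set) \<Rightarrow> bool" where
  "pseudohalfplane_family L s \<longleftrightarrow> pseudoline_arrangement L \<and> (\<forall>l\<in>L. s l \<in> sides l)"

section \<open>The plane graph of an arrangement and combinatorial equivalence\<close>

definition vertices :: "point set set \<Rightarrow> point set" where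
  "vertices L = {p. \<exists>l\<in>L. \<exists>m\<in>L. l \<noteq> m \<and> p \<in> l \<inter> m}"

definition edges :: "point set set \<Rightarrow> point set set" where
  "edges L = (\<Union>l\<in>L. components (l - vertices L))"

definition faces :: "point set set \<Rightarrow> point set set" where
  "faces L = components (- \<Union>L)"

text \<open>Incidence is expressed with closures because edges and faces are relatively open.
  The remaining adjacencies (two vertices joined by an edge, two faces sharing an edge, a
  pseudoline bounding a face) are determined by the incidences listed here.\<close>

definition combinatorially_equivalent :: "point set set \<Rightarrow> point set set \<Rightarrow> bool" where
  "combinatorially_equivalent L L' \<longleftrightarrow>
     (\<exists>fl fv fe ff.
        bij_betw fl L L' \<and>
        bij_betw fv (vertices L) (vertices L') \<and>
        bij_betw fe (edges L) (edges L') \<and>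
        bij_betw ff (faces L) (faces L') \<and>
        (\<forall>v\<in>vertices L. \<forall>l\<in>L. v \<in> l \<longleftrightarrow> fv v \<in> fl l) \<and>
        (\<forall>e\<in>edges L. \<forall>l\<in>L. e \<subseteq> l \<longleftrightarrow> fe e \<subseteq> fl l) \<and>
        (\<forall>v\<in>vertices L. \<forall>e\<in>edges L. v \<in> closure e \<longleftrightarrow> fv v \<in> closure (fe e)) \<and>
        (\<forall>v\<in>vertices L. \<forall>F\<in>faces L. v \<in> closure F \<longleftrightarrow> fv v \<in> closure (ff F)) \<and>
        (\<forall>e\<in>edges L. \<forall>F\<in>faces L. e \<subseteq> closure F \<longleftrightarrow> fe e \<subseteq> closure (ff F)))"

section \<open>Hypergraphs and their realizations\<close>

definition one_point_per_face :: "point set \<Rightarrow> point set set \<Rightarrow> bool" where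
  "one_point_per_face P L \<longleftrightarrow> P \<subseteq> \<Union>(faces L) \<and> (\<forall>F\<in>faces L. \<exists>!p. p \<in> P \<inter> F)"

definition side_hyperedges ::
    "point set \<Rightarrow> point set set \<Rightarrow> (point set \<Rightarrow> point set) \<Rightarrow> point set set" where
  "side_hyperedges P L s = (\<lambda>l. P \<inter> s l) ` L"

text \<open>A realization of the hypergraph with vertex set \<open>V\<close> and hyperedge set \<open>E\<close>: the placement
  \<open>\<pi>\<close> of the vertices, the pseudohalfplane family \<open>(L, s)\<close>, and the correspondence \<open>b\<close> sending
  a hyperedge to the boundary pseudoline of its pseudohalfplane.

  Placed points lie off the boundary pseudolines, so that a point not contained in a
  pseudohalfplane is on the other side. Without this, three concurrent pseudolines
  with a point placed at their common intersection would realize the hypergraph of three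
  pseudolines bounding a triangle, when the chosen sides are those avoiding the triangle.\<close>

definition pseudohalfplane_realization ::
    "'v set \<Rightarrow> 'v set set \<Rightarrow> ('v \<Rightarrow> point) \<Rightarrow> point set set \<Rightarrow> (point set \<Rightarrow> point set) \<Rightarrow>
     ('v set \<Rightarrow> point set) \<Rightarrow> bool" where
  "pseudohalfplane_realization V E \<pi> L s b \<longleftrightarrow>
     inj_on \<pi> V \<and> pseudohalfplane_family L s \<and> bij_betw b E L \<and>
     (\<forall>e\<in>E. {v \<in> V. \<pi> v \<in> s (b e)} = e) \<and>
     (\<forall>v\<in>V. \<forall>l\<in>L. \<pi> v \<notin> l)"

end

(* Record a point by its sign vector, the list of its sides with respect to the pseudolines.
   Every set given by prescribing some of the signs is connected.  Hence if the four faces around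
   the crossing of two pseudolines of the simple arrangement A are realized, three applications of
   the intermediate value theorem show that the corresponding crossing of the realizing arrangement
   has the same signs.  So that arrangement is simple and has the same sign vectors of vertices.
   Each cell has a vertex in its closure, and in a simple arrangement all sign vectors refining that
   of a vertex occur near it, so the sign vectors of all cells agree.  In a simple arrangement
   incidence is refinement of sign vectors, which gives the combinatorial equivalence. *)

theory Submission
  imports Defs
begin

text \<open>The hypergraph only guarantees that each face of A has a realized point with the same
  signs. The realization might have further cells, and a priori also concurrent curves. So until the
  crossings have been transferred, only facts valid in every arrangement may be used there: cells
  are connected, and two curves meet once. Connectedness itself comes from the single crossing: the
  sign of the difference of two curves is monotone or antitone in x, so its level sets are
  intervals. To transfer the crossing of i and j, curve i is met once with the sign of j kept at 1
  and once with it kept at -1; then j is met along curve i. Conversely, a crossing in the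
  realization is the only common point of its pair, hence it is the image of the crossing of the
  same pair in A. This excludes concurrent curves, and then also cells that A lacks.\<close>

section \<open>Signs on the real line and connectedness\<close>

lemma sgn_affine_interval:
  fixes x0 c s a b x :: real
  assumes "c * sgn (a - x0) = s" "c * sgn (b - x0) = s" "a \<le> x" "x \<le> b"
  shows "c * sgn (x - x0) = s"
  using assms by (auto simp: sgn_if split: if_splits)

lemma finite_sets_separated:
  fixes A B :: "real set"
  assumes "finite A" "finite B" "\<And>a b. a \<in> A \<Longrightarrow> b \<in> B \<Longrightarrow> a < b"
  shows "\<exists>y. (\<forall>a\<in>A. a < y) \<and> (\<forall>b\<in>B. y < b)"
proof (cases "A = {} \<or> B = {}")
  case True
  then show ?thesis
  proof
    assume "A = {}"
    moreover have "\<exists>y. \<forall>b\<in>B. y < b"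
      using \<open>finite B\<close> by (metis Min_le empty_iff less_le_trans lt_ex)
    ultimately show ?thesis by simp
  next
    assume "B = {}"
    moreover have "\<exists>y. \<forall>a\<in>A. a < y"
      using \<open>finite A\<close> by (metis Max_ge empty_iff le_less_trans gt_ex)
    ultimately show ?thesis by simp
  qed
next
  case False
  then have "Max A < Min B" using assms by simp
  then obtain y where "Max A < y" "y < Min B" using dense by blast
  then show ?thesis using assms False by (intro exI[of _ y]) auto
qed

text \<open>An open set projects openly, so a separation of it would separate the projection
  unless both parts meet a common fibre.\<close>

lemma connected_open_fibres:
  fixes S :: "('a::topological_space \<times> 'b::topological_space) set"
  assumes "open S" "connected (fst ` S)" "\<And>x. connected {y. (x, y) \<in> S}"
  shows "connected S"
proof (rule connectedI)
  fix U V
  assume UV: "open U" "open V" "U \<inter> S \<noteq> {}" "V \<inter> S \<noteq> {}" "U \<inter> V \<inter> S = {}" "S \<subseteq> U \<union> V"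
  have "open (fst ` (U \<inter> S))" "open (fst ` (V \<inter> S))"
    using UV assms(1) by (auto intro!: open_image_fst)
  moreover have "fst ` S \<subseteq> fst ` (U \<inter> S) \<union> fst ` (V \<inter> S)"
    using UV by blast
  ultimately have "fst ` (U \<inter> S) \<inter> fst ` (V \<inter> S) \<inter> fst ` S \<noteq> {}"
    using connectedD[OF assms(2), of "fst ` (U \<inter> S)" "fst ` (V \<inter> S)"] UV by blast
  then obtain x y z where xyz: "(x, y) \<in> U \<inter> S" "(x, z) \<in> V \<inter> S" by force
  define U' V' where "U' = (\<lambda>y. (x, y)) -` U" and "V' = (\<lambda>y. (x, y)) -` V"
  have "open U'" "open V'"
    unfolding U'_def V'_def using UV by (auto intro!: open_vimage continuous_intros)
  moreover have "{y. (x, y) \<in> S} \<subseteq> U' \<union> V'" "U' \<inter> V' \<inter> {y. (x, y) \<in> S} = {}"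
    using UV unfolding U'_def V'_def by blast+
  ultimately show False
    using connectedD[OF assms(3)[of x], of U' V'] xyz unfolding U'_def V'_def by blast
qed

text \<open>The level sets of \<open>\<kappa>\<close> partition \<open>S\<close> into relatively
  open sets, so each is clopen and cannot be a proper part of a component. Below,
  \<open>\<kappa>\<close> is the sign vector.\<close>

lemma components_level_sets:
  fixes S :: "'a::topological_space set" and \<kappa> :: "'a \<Rightarrow> 'k"
  assumes conn: "\<And>p. p \<in> S \<Longrightarrow> connected {q\<in>S. \<kappa> q = \<kappa> p}"
    and op: "\<And>p. p \<in> S \<Longrightarrow> openin (top_of_set S) {q\<in>S. \<kappa> q = \<kappa> p}"
  shows "components S = (\<lambda>p. {q\<in>S. \<kappa> q = \<kappa> p}) ` S"
proof -
  have "connected_component_set S p = {q\<in>S. \<kappa> q = \<kappa> p}" if p: "p \<in> S" for p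
  proof (rule antisym)
    show "{q \<in> S. \<kappa> q = \<kappa> p} \<subseteq> connected_component_set S p"
      using p conn by (intro connected_component_maximal) auto
    let ?E = "{q \<in> S. \<kappa> q = \<kappa> p}" and ?F = "\<Union>p'\<in>{p'\<in>S. \<kappa> p' \<noteq> \<kappa> p}. {q \<in> S. \<kappa> q = \<kappa> p'}"
    have "openin (top_of_set S) ?F" using op by (intro openin_Union) auto
    moreover have "?F = S - ?E" by auto
    ultimately have "closedin (top_of_set S) ?E"
      by (auto simp: closedin_def)
    moreover have "connectedin (top_of_set S) (connected_component_set S p)"
      by (simp add: connectedin_subtopology connected_component_subset)
    ultimately have "connected_component_set S p \<subseteq> ?E \<or> disjnt (connected_component_set S p) ?E"
      using op[OF p] connectedin_clopen_cases by blast
    then show "connected_component_set S p \<subseteq> ?E"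
      using p by (auto simp: disjnt_iff)
  qed
  then show ?thesis unfolding components_def by auto
qed

text \<open>A local sign change becomes a global one: a wrong sign at some \<open>x\<close> on one
  side of \<open>x0\<close> would force a second zero on that side.\<close>

lemma sgn_crossing:
  fixes h :: "real \<Rightarrow> real"
  assumes h: "continuous_on UNIV h" and zero: "\<And>x. h x = 0 \<longleftrightarrow> x = x0"
    and cross: "(\<forall>\<^sub>F x in at_left x0. h x < 0) \<and> (\<forall>\<^sub>F x in at_right x0. h x > 0)"
  shows "sgn (h x) = sgn (x - x0)"
proof -
  obtain a where a: "a < x0" "h a < 0"
    using cross unfolding eventually_at_left_field by (metis dense less_imp_le lt_ex)
  obtain b where b: "b > x0" "h b > 0"
    using cross unfolding eventually_at_right_field by (metis dense less_imp_le gt_ex)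
  \<comment> \<open>Both orders of \<open>u\<close> and \<open>v\<close> occur, since
    \<open>x\<close> may lie on either side of the sample point \<open>a\<close> or
    \<open>b\<close>.\<close>
  have between: "\<exists>z. h z = 0 \<and> min u v \<le> z \<and> z \<le> max u v" if "h u < 0" "h v > 0" for u v
  proof (cases "u \<le> v")
    case True
    then show ?thesis
      using that IVT'[of h u 0 v] continuous_on_subset[OF h] by (auto simp: min_def max_def)
  next
    case False
    then show ?thesis
      using that IVT2'[of h u 0 v] continuous_on_subset[OF h] by (auto simp: min_def max_def)
  qed
  consider "x < x0" | "x = x0" | "x > x0" by linarith
  then show ?thesis
  proof cases
    case 1
    then have "\<not> h x > 0" using between[of a x] zero a by (auto simp: min_def max_def split: if_splits)
    then show ?thesis using 1 zero[of x] by (auto simp: sgn_if)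
  next
    case 2
    then have "h x = 0" using zero by blast
    then show ?thesis using 2 by simp
  next
    case 3
    then have "\<not> h x < 0" using between[of x b] zero b by (auto simp: min_def max_def split: if_splits)
    then show ?thesis using 3 zero[of x] by (auto simp: sgn_if)
  qed
qed

text \<open>If \<open>b\<close> were on the segment from \<open>y\<close> to \<open>a\<close>, it
  would be strictly nearer to \<open>y\<close>. Used for heights in \<open>nearest_line\<close> and
  for abscissas in \<open>nearest_vertex_on_line\<close>.\<close>

lemma sgn_diff_nearer:
  fixes a b y :: real
  assumes "\<bar>y - a\<bar> \<le> \<bar>y - b\<bar>" "a \<noteq> b"
  shows "sgn (a - b) = sgn (y - b)"
  using assms by (cases a b rule: linorder_cases) (auto simp: sgn_if)

text \<open>One formula for all nine sign pairs. The hypothesis on \<open>m - n\<close> says that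
  the two heights are ordered so as to leave room for the signs. If \<open>a \<noteq> b\<close>, the
  gap has positive width and \<open>y\<close> is its midpoint or one of its ends; if
  \<open>a = b\<close>, then \<open>m = n\<close> and the offset \<open>t\<close> provides the
  distance.\<close>

lemma sgn_choose:
  fixes a b m n t :: real
  assumes "a = 0 \<or> a = 1 \<or> a = -1" "b = 0 \<or> b = 1 \<or> b = -1" "t > 0" "sgn (m - n) = sgn (b - a)"
  defines "y \<equiv> (m + n) / 2 + (a + b) / 2 * (\<bar>m - n\<bar> + (if a = b then t else 0))"
  shows "sgn (y - m) = a \<and> sgn (y - n) = b"
proof (cases m n rule: linorder_cases)
  case less
  then have "a > b" using assms(4) by (auto simp: sgn_if split: if_splits)
  then show ?thesis using less assms(1,2) by (elim disjE) (auto simp: y_def sgn_if field_simps)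
next
  case equal
  then have "a = b" using assms(4) by (auto simp: sgn_if split: if_splits)
  then show ?thesis using equal assms(1,3) by (elim disjE) (auto simp: y_def sgn_if field_simps)
next
  case greater
  then have "a < b" using assms(4) by (auto simp: sgn_if split: if_splits)
  then show ?thesis using greater assms(1,2) by (elim disjE) (auto simp: y_def sgn_if field_simps)
qed

section \<open>Pseudoline arrangements as systems of functions\<close>

lemma curve_graph_iff: "p \<in> curve_graph f \<longleftrightarrow> snd p = f (fst p)"
  by (cases p) (auto simp: curve_graph_def)

lemma curve_graph_inject [simp]: "curve_graph f = curve_graph g \<longleftrightarrow> f = g"
proof
  assume "curve_graph f = curve_graph g"
  then have "(x, f x) \<in> curve_graph g" for x by (metis curve_graph_iff fst_conv snd_conv)
  then show "f = g" by (auto simp: curve_graph_iff)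
qed simp

text \<open>\<open>e i\<close> records which side of the graph of \<open>f i\<close> counts as positive.\<close>

locale pseudoline_system =
  fixes I :: "'i set" and f :: "'i \<Rightarrow> real \<Rightarrow> real" and e :: "'i \<Rightarrow> real"
  assumes finite_I: "finite I"
    and cont: "i \<in> I \<Longrightarrow> continuous_on UNIV (f i)"
    and orient: "i \<in> I \<Longrightarrow> e i = 1 \<or> e i = -1"
    and cross: "i \<in> I \<Longrightarrow> j \<in> I \<Longrightarrow> i \<noteq> j \<Longrightarrow>
      \<exists>x0 d. (d = 1 \<or> d = -1) \<and> (\<forall>x. sgn (f i x - f j x) = d * sgn (x - x0))"
begin

section \<open>Side signs and connectedness of cells\<close>

definition side_sign :: "'i \<Rightarrow> point \<Rightarrow> real" where
  "side_sign i p = e i * sgn (snd p - f i (fst p))"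

text \<open>\<open>J\<close> may omit a curve, so that the curve can be crossed inside the cell; a
  prescribed value 0 places the cell on a curve.\<close>

definition cell :: "'i set \<Rightarrow> ('i \<Rightarrow> real) \<Rightarrow> point set" where
  "cell J \<sigma> = {p. \<forall>i\<in>J. side_sign i p = \<sigma> i}"

definition lines :: "point set set" where
  "lines = (\<lambda>i. curve_graph (f i)) ` I"

lemma continuous_height: "i \<in> I \<Longrightarrow> continuous_on UNIV (\<lambda>p::point. snd p - f i (fst p))"
  by (intro continuous_intros continuous_on_compose2[OF cont]) auto

lemma side_sign_zero_iff: "i \<in> I \<Longrightarrow> side_sign i p = 0 \<longleftrightarrow> snd p = f i (fst p)"
  using orient[of i] by (auto simp: side_sign_def sgn_if)

lemma side_sign_zero_iff_mem: "i \<in> I \<Longrightarrow> side_sign i p = 0 \<longleftrightarrow> p \<in> curve_graph (f i)"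
  by (simp add: side_sign_zero_iff curve_graph_iff)

lemma side_sign_cases: "i \<in> I \<Longrightarrow> side_sign i p = 0 \<or> side_sign i p = 1 \<or> side_sign i p = -1"
  using orient[of i] by (auto simp: side_sign_def sgn_if)

lemma open_side_sign:
  assumes "i \<in> I" "s \<noteq> 0"
  shows "open {p. side_sign i p = s}"
proof -
  let ?h = "\<lambda>p::point. snd p - f i (fst p)"
  have "open {p. ?h p > 0}" "open {p. ?h p < 0}"
    by (intro open_Collect_less continuous_height continuous_on_const assms(1))+
  moreover have "{p. side_sign i p = s} = (if s = e i then {p. ?h p > 0} else if s = - e i then {p. ?h p < 0} else {})"
    using assms orient[of i] by (auto simp: side_sign_def sgn_if)
  ultimately show ?thesis by simp
qed

lemma open_cell:
  assumes "J \<subseteq> I" "\<And>i. i \<in> J \<Longrightarrow> \<sigma> i \<noteq> 0"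
  shows "open (cell J \<sigma>)"
proof -
  have "cell J \<sigma> = (\<Inter>i\<in>J. {p. side_sign i p = \<sigma> i})" by (auto simp: cell_def)
  moreover have "finite J" using assms finite_I finite_subset by blast
  ultimately show ?thesis using assms by (auto intro!: open_INT open_side_sign)
qed

text \<open>By single crossing the sign of the difference is \<open>d * sgn (x - x0)\<close>, which
  is monotone or antitone in \<open>x\<close>. Only in this form does single crossing enter
  \<open>connected_cell\<close>.\<close>

lemma sgn_diff_interval:
  assumes "i \<in> I" "j \<in> I" "c * sgn (f i a - f j a) = s" "c * sgn (f i b - f j b) = s" "a \<le> x" "x \<le> b"
  shows "c * sgn (f i x - f j x) = s"
proof (cases "i = j")
  case False
  then obtain x0 d where "\<forall>x. sgn (f i x - f j x) = d * sgn (x - x0)" using cross assms by blast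
  then show ?thesis using assms sgn_affine_interval[of "c * d" a x0 s b x] by (simp add: mult.assoc)
qed (use assms in simp)

lemma connected_cell:
  assumes J: "J \<subseteq> I"
  shows "connected (cell J \<sigma>)"
proof (cases "\<exists>i\<in>J. \<sigma> i = 0")
  case True
  then obtain i where i: "i \<in> J" "\<sigma> i = 0" by blast
  \<comment> \<open>The cell lies on curve \<open>i\<close>, where all signs depend on
    \<open>x\<close> alone; it is the part of that curve over the interval \<open>X\<close>.\<close>
  define X where "X = {x. \<forall>k\<in>J. e k * sgn (f i x - f k x) = \<sigma> k}"
  have "is_interval X"
    unfolding is_interval_1 X_def using sgn_diff_interval i J by blast
  then have "connected ((\<lambda>x. (x, f i x)) ` X)"
    using i J by (intro connected_continuous_image is_interval_connected continuous_intros
        continuous_on_subset[OF cont]) auto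
  moreover have "cell J \<sigma> = (\<lambda>x. (x, f i x)) ` X"
  proof
    show "(\<lambda>x. (x, f i x)) ` X \<subseteq> cell J \<sigma>" by (auto simp: X_def cell_def side_sign_def)
    show "cell J \<sigma> \<subseteq> (\<lambda>x. (x, f i x)) ` X"
    proof
      fix p assume p: "p \<in> cell J \<sigma>"
      then have "p = (fst p, f i (fst p))"
        using i J side_sign_zero_iff[of i p] by (auto simp: cell_def prod_eq_iff)
      moreover have "fst p \<in> X"
        using p i J side_sign_zero_iff[of i p] by (auto simp: X_def cell_def side_sign_def)
      ultimately show "p \<in> (\<lambda>x. (x, f i x)) ` X" by blast
    qed
  qed
  ultimately show ?thesis by simp
next
  case False
  show ?thesis
  proof (rule connected_open_fibres)
    show "open (cell J \<sigma>)" using J False by (intro open_cell) auto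
    show "connected {y. (x, y) \<in> cell J \<sigma>}" for x
    proof -
      have "side_sign i (x, y) = \<sigma> i" if "i \<in> J" "side_sign i (x, a) = \<sigma> i" "side_sign i (x, b) = \<sigma> i" "a \<le> y" "y \<le> b" for i a b y
        using that sgn_affine_interval[of "e i" a "f i x" "\<sigma> i" b y] by (simp add: side_sign_def)
      then have "is_interval {y. (x, y) \<in> cell J \<sigma>}"
        unfolding is_interval_1 cell_def by blast
      then show ?thesis by (rule is_interval_connected)
    qed
    \<comment> \<open>The projection is an interval: a curve that must run below another one does so
      over \<open>p\<close> and over \<open>q\<close>, hence also over \<open>x\<close>. A height
      separating the two groups of curves then gives a point over \<open>x\<close>.\<close>
    have "x \<in> fst ` cell J \<sigma>" if p: "p \<in> cell J \<sigma>" and q: "q \<in> cell J \<sigma>" and x: "fst p \<le> x" "x \<le> fst q" for p q x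
    proof -
      \<comment> \<open>Multiplying by \<open>e i\<close> removes the orientation: \<open>Lo\<close>
        bounds the cell from below, \<open>Up\<close> from above.\<close>
      define Lo Up where "Lo = {i\<in>J. \<sigma> i = e i}" and "Up = {i\<in>J. \<sigma> i = - e i}"
      have fin: "finite Lo" "finite Up"
        unfolding Lo_def Up_def using J finite_I by (auto intro: finite_subset)
      have *: "f i (fst r) < snd r" "snd r < f j (fst r)" if "i \<in> Lo" "j \<in> Up" "r \<in> cell J \<sigma>" for i j r
      proof -
        have "i \<in> I" "j \<in> I" "side_sign i r = e i" "side_sign j r = - e j"
          using that J by (auto simp: Lo_def Up_def cell_def)
        then show "f i (fst r) < snd r" "snd r < f j (fst r)"
          using orient[of i] orient[of j] by (auto simp: side_sign_def sgn_if split: if_splits)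
      qed
      have JLU: "i \<in> Lo \<or> i \<in> Up" if "i \<in> J" for i
      proof -
        have "i \<in> I" "side_sign i p = \<sigma> i" "\<sigma> i \<noteq> 0" using p that J False by (auto simp: cell_def)
        then show ?thesis
          using side_sign_cases[of i p] orient[of i] that by (auto simp: Lo_def Up_def)
      qed
      have "f i x < f j x" if "i \<in> Lo" "j \<in> Up" for i j
      proof -
        have "1 * sgn (f i x - f j x) = -1"
        proof (rule sgn_diff_interval)
          show "i \<in> I" "j \<in> I" using that J unfolding Lo_def Up_def by auto
          show "1 * sgn (f i (fst p) - f j (fst p)) = -1" "1 * sgn (f i (fst q) - f j (fst q)) = -1"
            using *[OF that p] *[OF that q] by auto
        qed (use x in auto)
        then show ?thesis by (auto simp: sgn_if split: if_splits)
      qed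
      then obtain y where y: "\<forall>i\<in>Lo. f i x < y" "\<forall>j\<in>Up. y < f j x"
        using finite_sets_separated[of "(\<lambda>i. f i x) ` Lo" "(\<lambda>i. f i x) ` Up"] fin by auto
      have "side_sign i (x, y) = \<sigma> i" if "i \<in> J" for i
        using JLU[OF that] y unfolding side_sign_def by (auto simp: Lo_def Up_def)
      then have "(x, y) \<in> cell J \<sigma>" by (simp add: cell_def)
      then show ?thesis by force
    qed
    then have "is_interval (fst ` cell J \<sigma>)" unfolding is_interval_1 by blast
    then show "connected (fst ` cell J \<sigma>)" by (rule is_interval_connected)
  qed
qed

lemma side_sign_zero_between:
  assumes "connected C" "i \<in> I" "p \<in> C" "q \<in> C" "side_sign i p = 1" "side_sign i q = -1"
  shows "\<exists>r\<in>C. side_sign i r = 0"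
proof -
  let ?h = "\<lambda>p::point. snd p - f i (fst p)"
  have "connected (?h ` C)"
    using assms by (intro connected_continuous_image continuous_on_subset[OF continuous_height]) auto
  moreover have "?h p \<le> 0 \<and> 0 \<le> ?h q \<or> ?h q \<le> 0 \<and> 0 \<le> ?h p"
    using assms orient[of i] by (auto simp: side_sign_def sgn_if split: if_splits)
  ultimately have "0 \<in> ?h ` C"
    using assms connectedD_interval[of "?h ` C" "?h p" "?h q" 0] connectedD_interval[of "?h ` C" "?h q" "?h p" 0]
    by blast
  then obtain r where "r \<in> C" "?h r = 0" by force
  then show ?thesis using side_sign_zero_iff[OF assms(2), of r] by auto
qed

lemma curve_graph_inj: "inj_on (\<lambda>i. curve_graph (f i)) I"
proof
  fix i j assume ij: "i \<in> I" "j \<in> I" "curve_graph (f i) = curve_graph (f j)"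
  show "i = j"
  proof (rule ccontr)
    assume "i \<noteq> j"
    then obtain x0 d where "d = 1 \<or> d = -1" "\<forall>x. sgn (f i x - f j x) = d * sgn (x - x0)"
      using cross ij by meson
    then show False using ij by (auto dest: spec[of _ "x0 + 1"])
  qed
qed

section \<open>Vertices, edges and faces in terms of signs\<close>

abbreviation cell_of :: "point \<Rightarrow> point set" where
  "cell_of p \<equiv> cell I (\<lambda>i. side_sign i p)"

lemma mem_cell_of [simp]: "p \<in> cell_of p"
  by (simp add: cell_def)

lemma mem_vertices: "p \<in> vertices lines \<longleftrightarrow>
    (\<exists>i\<in>I. \<exists>j\<in>I. i \<noteq> j \<and> side_sign i p = 0 \<and> side_sign j p = 0)"
proof
  assume "p \<in> vertices lines"
  then obtain i j where "i \<in> I" "j \<in> I" "curve_graph (f i) \<noteq> curve_graph (f j)"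
    "p \<in> curve_graph (f i)" "p \<in> curve_graph (f j)"
    unfolding vertices_def lines_def by blast
  then show "\<exists>i\<in>I. \<exists>j\<in>I. i \<noteq> j \<and> side_sign i p = 0 \<and> side_sign j p = 0"
    using side_sign_zero_iff_mem by metis
next
  assume "\<exists>i\<in>I. \<exists>j\<in>I. i \<noteq> j \<and> side_sign i p = 0 \<and> side_sign j p = 0"
  then obtain i j where ij: "i \<in> I" "j \<in> I" "i \<noteq> j" "side_sign i p = 0" "side_sign j p = 0"
    by blast
  then have "curve_graph (f i) \<noteq> curve_graph (f j)" "p \<in> curve_graph (f i) \<inter> curve_graph (f j)"
    using curve_graph_inj by (simp_all add: inj_on_def side_sign_zero_iff_mem del: curve_graph_inject) blast
  then show "p \<in> vertices lines"
    using ij unfolding vertices_def lines_def by blast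
qed

lemma faces_eq: "faces lines = cell_of ` {p. \<forall>i\<in>I. side_sign i p \<noteq> 0}"
proof -
  \<comment> \<open>The restriction discards indices outside \<open>I\<close>, for which
    \<open>f\<close> and \<open>e\<close> are arbitrary.\<close>
  let ?S = "{p. \<forall>i\<in>I. side_sign i p \<noteq> 0}" and ?k = "\<lambda>p. restrict (\<lambda>i. side_sign i p) I"
  have level: "{q\<in>?S. ?k q = ?k p} = cell_of p" if "p \<in> ?S" for p
    using that by (auto simp: cell_def fun_eq_iff restrict_def)
  have "- \<Union>lines = ?S" by (auto simp: lines_def side_sign_zero_iff_mem)
  moreover have "components ?S = (\<lambda>p. {q\<in>?S. ?k q = ?k p}) ` ?S"
  proof (rule components_level_sets)
    fix p assume p: "p \<in> ?S"
    show "connected {q\<in>?S. ?k q = ?k p}" unfolding level[OF p] by (simp add: connected_cell)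
    have "open (cell_of p)" using p by (intro open_cell) auto
    then show "openin (top_of_set ?S) {q\<in>?S. ?k q = ?k p}"
      unfolding level[OF p] by (intro open_subset) (use level[OF p] in auto)
  qed
  ultimately show ?thesis unfolding faces_def using level by auto
qed

lemma edges_eq:
  "edges lines = cell_of ` {p. \<exists>i\<in>I. side_sign i p = 0 \<and> (\<forall>j\<in>I-{i}. side_sign j p \<noteq> 0)}"
proof -
  have "components (curve_graph (f i) - vertices lines) =
      cell_of ` {p. side_sign i p = 0 \<and> (\<forall>j\<in>I-{i}. side_sign j p \<noteq> 0)}" if i: "i \<in> I" for i
  proof -
    let ?S = "{p. side_sign i p = 0 \<and> (\<forall>j\<in>I-{i}. side_sign j p \<noteq> 0)}"
      and ?k = "\<lambda>p. restrict (\<lambda>i. side_sign i p) I"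
    have level: "{q\<in>?S. ?k q = ?k p} = cell_of p" if "p \<in> ?S" for p
      using that i by (auto simp: cell_def fun_eq_iff restrict_def)
    have "curve_graph (f i) - vertices lines = ?S"
      unfolding set_eq_iff Diff_iff mem_vertices mem_Collect_eq side_sign_zero_iff_mem[OF i, symmetric]
      using i by blast
    moreover have "components ?S = (\<lambda>p. {q\<in>?S. ?k q = ?k p}) ` ?S"
    proof (rule components_level_sets)
      fix p assume p: "p \<in> ?S"
      show "connected {q\<in>?S. ?k q = ?k p}" unfolding level[OF p] by (simp add: connected_cell)
      \<comment> \<open>The full cell has sign 0 at \<open>i\<close>, so \<open>open_cell\<close>
        does not apply to it. Dropping \<open>i\<close> gives an open set with the right trace on
        the curve.\<close>
      have "open (cell (I-{i}) (\<lambda>i. side_sign i p))" using p by (intro open_cell) auto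
      moreover have "cell_of p = ?S \<inter> cell (I-{i}) (\<lambda>i. side_sign i p)"
        using p i by (auto simp: cell_def)
      ultimately show "openin (top_of_set ?S) {q\<in>?S. ?k q = ?k p}"
        unfolding level[OF p] by (simp add: openin_open_Int)
    qed
    ultimately show ?thesis using level by auto
  qed
  then have "edges lines =
      (\<Union>i\<in>I. cell_of ` {p. side_sign i p = 0 \<and> (\<forall>j\<in>I-{i}. side_sign j p \<noteq> 0)})"
    unfolding edges_def lines_def image_image by simp
  then show ?thesis by blast
qed

section \<open>Closures of cells as refinement of signs\<close>

text \<open>A nonzero sign is locally constant. This half of the closure criterion holds in every
  arrangement.\<close>

lemma closure_cell_sign:
  assumes "p \<in> closure (cell I \<sigma>)" "i \<in> I" "side_sign i p \<noteq> 0"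
  shows "\<sigma> i = side_sign i p"
proof -
  have "open {q. side_sign i q = side_sign i p}" using assms by (intro open_side_sign)
  then obtain q where "q \<in> cell I \<sigma>" "side_sign i q = side_sign i p"
    using assms unfolding closure_iff_nhds_not_empty by blast
  then show ?thesis using assms by (simp add: cell_def)
qed

definition simple_system :: bool where
  "simple_system \<longleftrightarrow> (\<forall>i\<in>I. \<forall>j\<in>I. \<forall>k\<in>I. \<forall>p. i \<noteq> j \<and> i \<noteq> k \<and> j \<noteq> k \<longrightarrow>
     \<not> (side_sign i p = 0 \<and> side_sign j p = 0 \<and> side_sign k p = 0))"

text \<open>Curves not through \<open>p\<close> keep their signs near \<open>p\<close>, and there
  are finitely many. So a path leaving \<open>p\<close> only has to produce the right signs at the
  curves through \<open>p\<close>.\<close>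

lemma closure_cell_path:
  assumes refine: "\<And>i. i \<in> I \<Longrightarrow> side_sign i p \<noteq> 0 \<Longrightarrow> \<sigma> i = side_sign i p"
    and \<gamma>: "continuous_on UNIV \<gamma>" "\<gamma> (0::real) = p"
    and zero: "\<And>i t. i \<in> I \<Longrightarrow> side_sign i p = 0 \<Longrightarrow> t > 0 \<Longrightarrow> side_sign i (\<gamma> t) = \<sigma> i"
  shows "p \<in> closure (cell I \<sigma>)"
proof -
  have lim: "(\<gamma> \<longlongrightarrow> p) (at_right 0)"
    using \<gamma> by (metis UNIV_I continuous_on_def filterlim_at_split tendsto_within_subset subset_UNIV)
  have "\<forall>\<^sub>F t in at_right 0. side_sign i (\<gamma> t) = \<sigma> i" if i: "i \<in> I" for i
  proof (cases "side_sign i p = 0")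
    case True
    then show ?thesis using zero i by (auto simp: eventually_at_right_less intro: eventually_mono[OF eventually_at_right_less])
  next
    case False
    then have "open {q. side_sign i q = \<sigma> i}" "p \<in> {q. side_sign i q = \<sigma> i}"
      using i refine by (auto intro!: open_side_sign)
    then have "\<forall>\<^sub>F t in at_right 0. \<gamma> t \<in> {q. side_sign i q = \<sigma> i}"
      using lim topological_tendstoD by blast
    then show ?thesis by simp
  qed
  then have "\<forall>\<^sub>F t in at_right 0. \<gamma> t \<in> cell I \<sigma>"
    using finite_I by (simp add: cell_def eventually_ball_finite_distrib)
  then have "\<forall>\<^sub>F t in at_right 0. \<gamma> t \<in> closure (cell I \<sigma>)"
    by (rule eventually_mono) (use closure_subset in blast)
  then show ?thesis
    using Lim_in_closed_set[OF closed_closure _ _ lim] by simp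
qed

text \<open>By simplicity at most two curves pass through \<open>p\<close>, and for zero, one or two
  of them an explicit path realizes any choice of signs.\<close>

lemma closure_cellI:
  assumes simple: simple_system
    and \<sigma>: "\<And>i. i \<in> I \<Longrightarrow> \<sigma> i = 0 \<or> \<sigma> i = 1 \<or> \<sigma> i = -1"
    and refine: "\<And>i. i \<in> I \<Longrightarrow> side_sign i p \<noteq> 0 \<Longrightarrow> \<sigma> i = side_sign i p"
  shows "p \<in> closure (cell I \<sigma>)"
proof -
  consider "\<forall>i\<in>I. side_sign i p \<noteq> 0"
    | i where "i \<in> I" "side_sign i p = 0" "\<forall>j\<in>I-{i}. side_sign j p \<noteq> 0"
    | i j where "i \<in> I" "j \<in> I" "i \<noteq> j" "side_sign i p = 0" "side_sign j p = 0"
    by blast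
  then show ?thesis
  proof cases
    case 1
    then show ?thesis by (intro closure_cell_path[OF refine, of "\<lambda>_. p"]) auto
  next
    case (2 i)
    \<comment> \<open>A vertical path off the single curve through \<open>p\<close>; it stays at
      \<open>p\<close> if \<open>\<sigma> i = 0\<close>.\<close>
    let ?\<gamma> = "\<lambda>t. (fst p, f i (fst p) + e i * \<sigma> i * t)"
    show ?thesis
    proof (rule closure_cell_path[OF refine, of ?\<gamma>])
      show "continuous_on UNIV ?\<gamma>" by (intro continuous_intros)
      show "?\<gamma> 0 = p" using 2 side_sign_zero_iff[of i p] by (simp add: prod_eq_iff)
      fix k t assume k: "k \<in> I" "side_sign k p = 0" "t > (0::real)"
      then have "k = i" using 2 by blast
      then show "side_sign k (?\<gamma> t) = \<sigma> k"
        using 2 k orient[of i] \<sigma>[of i] by (auto simp: side_sign_def sgn_mult)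
    qed
  next
    case (3 i j)
    define x where "x = fst p"
    have fx: "snd p = f i x" "f i x = f j x"
      using 3 side_sign_zero_iff[of i p] side_sign_zero_iff[of j p] by (auto simp: x_def)
    obtain x0 d where d: "d = 1 \<or> d = -1" and "\<forall>z. sgn (f i z - f j z) = d * sgn (z - x0)"
      using cross[OF 3(1-3)] by blast
    then have cr: "sgn (f i z - f j z) = d * sgn (z - x0)" for z by blast
    have "x0 = x" using cr[of x] d fx by (auto simp: sgn_if split: if_splits)
    define a b where "a = e i * \<sigma> i" and "b = e j * \<sigma> j"
    have ab: "a = 0 \<or> a = 1 \<or> a = -1" "b = 0 \<or> b = 1 \<or> b = -1"
      using \<sigma>[of i] \<sigma>[of j] orient[of i] orient[of j] 3 by (auto simp: a_def b_def)
    have ab_eq: "e i * a = \<sigma> i" "e j * b = \<sigma> j"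
      using orient[of i] orient[of j] 3 by (auto simp: a_def b_def)
    \<comment> \<open>Move towards the side on which the two curves leave room for the signs \<open>a\<close> and \<open>b\<close>;
      the factor \<open>(a + b) / 2\<close> selects below, between, on, or above the curves.\<close>
    let ?X = "\<lambda>t. x + d * (b - a) * t"
    let ?h = "\<lambda>t. f i (?X t) - f j (?X t)"
    let ?\<gamma> = "\<lambda>t. (?X t, (f i (?X t) + f j (?X t)) / 2 + (a + b) / 2 * (\<bar>?h t\<bar> + (if a = b then t else 0)))"
    show ?thesis
    proof (rule closure_cell_path[OF refine, of ?\<gamma>])
      have "continuous_on UNIV (\<lambda>t. f i (?X t))" "continuous_on UNIV (\<lambda>t. f j (?X t))"
        using 3 by (auto intro!: continuous_on_compose2[OF cont] continuous_intros)
      then show "continuous_on UNIV ?\<gamma>" by (cases "a = b") (auto intro!: continuous_intros)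
      show "?\<gamma> 0 = p" using fx by (simp add: prod_eq_iff x_def)
      fix k t assume k: "k \<in> I" "side_sign k p = 0" "t > (0::real)"
      then have kij: "k = i \<or> k = j" using 3 simple unfolding simple_system_def by metis
      \<comment> \<open>The factor \<open>d\<close> in \<open>?X\<close> cancels the
        \<open>d\<close> of the crossing, because \<open>d * d = 1\<close>.\<close>
      have "sgn (?h t) = sgn (b - a)"
        using cr[of "?X t"] \<open>x0 = x\<close> d k by (auto simp: sgn_mult)
      then have "sgn (snd (?\<gamma> t) - f i (?X t)) = a \<and> sgn (snd (?\<gamma> t) - f j (?X t)) = b"
        unfolding snd_conv by (intro sgn_choose ab k(3))
      then show "side_sign k (?\<gamma> t) = \<sigma> k"
        using kij ab_eq unfolding side_sign_def fst_conv by metis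
    qed
  qed
qed

lemma mem_closure_cell_of:
  assumes simple_system
  shows "p \<in> closure (cell_of q) \<longleftrightarrow> (\<forall>i\<in>I. side_sign i p \<noteq> 0 \<longrightarrow> side_sign i q = side_sign i p)"
proof
  assume "p \<in> closure (cell_of q)"
  then show "\<forall>i\<in>I. side_sign i p \<noteq> 0 \<longrightarrow> side_sign i q = side_sign i p"
    using closure_cell_sign[of p "\<lambda>i. side_sign i q"] by blast
next
  assume "\<forall>i\<in>I. side_sign i p \<noteq> 0 \<longrightarrow> side_sign i q = side_sign i p"
  then show "p \<in> closure (cell_of q)"
    using side_sign_cases by (intro closure_cellI assms) auto
qed

lemma cell_of_subset_closure:
  assumes simple_system
  shows "cell_of p \<subseteq> closure (cell_of q) \<longleftrightarrow> (\<forall>i\<in>I. side_sign i p \<noteq> 0 \<longrightarrow> side_sign i q = side_sign i p)"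
proof -
  have "cell_of p \<subseteq> closure (cell_of q)" if "p \<in> closure (cell_of q)"
  proof
    fix r assume "r \<in> cell_of p"
    then have "side_sign i r = side_sign i p" if "i \<in> I" for i using that by (simp add: cell_def)
    then show "r \<in> closure (cell_of q)"
      using \<open>p \<in> closure (cell_of q)\<close> unfolding mem_closure_cell_of[OF assms] by simp
  qed
  then have "cell_of p \<subseteq> closure (cell_of q) \<longleftrightarrow> p \<in> closure (cell_of q)"
    using mem_cell_of[of p] by blast
  then show ?thesis using mem_closure_cell_of[OF assms] by simp
qed

section \<open>From a point to a vertex whose signs it refines\<close>

text \<open>Moving vertically to a nearest curve passes no other curve; signs can only become 0 on
  arrival.\<close>

lemma nearest_line:
  assumes "I \<noteq> {}"
  shows "\<exists>i\<in>I. \<exists>q. side_sign i q = 0 \<and> (\<forall>k\<in>I. side_sign k q \<noteq> 0 \<longrightarrow> side_sign k q = side_sign k p)"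
proof -
  obtain i where i: "i \<in> I" "\<And>k. k \<in> I \<Longrightarrow> \<bar>snd p - f i (fst p)\<bar> \<le> \<bar>snd p - f k (fst p)\<bar>"
    using arg_min_if_finite[OF finite_I assms, of "\<lambda>i. \<bar>snd p - f i (fst p)\<bar>"] by (metis linorder_not_less)
  define q where "q = (fst p, f i (fst p))"
  have "side_sign k q = side_sign k p" if "k \<in> I" "side_sign k q \<noteq> 0" for k
    using that sgn_diff_nearer[OF i(2)] unfolding q_def by (auto simp: side_sign_def sgn_if)
  moreover have "side_sign i q = 0" by (simp add: side_sign_def q_def)
  ultimately show ?thesis using i by blast
qed

text \<open>Sliding along curve \<open>i\<close> to the crossing with nearest abscissa passes no
  other crossing, so again signs can only become 0.\<close>

lemma nearest_vertex_on_line: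
  assumes i: "i \<in> I" "side_sign i q = 0" and "I \<noteq> {i}"
  shows "\<exists>v j. j \<in> I \<and> j \<noteq> i \<and> side_sign i v = 0 \<and> side_sign j v = 0 \<and>
    (\<forall>k\<in>I. side_sign k v \<noteq> 0 \<longrightarrow> side_sign k v = side_sign k q)"
proof -
  have "\<forall>k\<in>I-{i}. \<exists>x0. \<exists>d. (d = 1 \<or> d = -1) \<and> (\<forall>x. sgn (f i x - f k x) = d * sgn (x - x0))"
    using cross i by blast
  from bchoice[OF this] obtain X where X: "\<And>k. k \<in> I \<Longrightarrow> k \<noteq> i \<Longrightarrow>
      \<exists>d. (d = 1 \<or> d = -1) \<and> (\<forall>x. sgn (f i x - f k x) = d * sgn (x - X k))"
    by blast
  have "I - {i} \<noteq> {}" using assms by blast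
  then have "arg_min_on (\<lambda>k. \<bar>fst q - X k\<bar>) (I - {i}) \<in> I - {i}"
    "\<not> (\<exists>k\<in>I-{i}. \<bar>fst q - X k\<bar> < \<bar>fst q - X (arg_min_on (\<lambda>k. \<bar>fst q - X k\<bar>) (I - {i}))\<bar>)"
    using finite_I by (intro arg_min_if_finite; blast)+
  then obtain j where "j \<in> I - {i}" "\<not> (\<exists>k\<in>I-{i}. \<bar>fst q - X k\<bar> < \<bar>fst q - X j\<bar>)"
    by blast
  then have j: "j \<in> I" "j \<noteq> i" "\<And>k. k \<in> I \<Longrightarrow> k \<noteq> i \<Longrightarrow> \<bar>fst q - X j\<bar> \<le> \<bar>fst q - X k\<bar>"
    by (auto simp: not_less)
  define v where "v = (X j, f i (X j))"
  have qi: "snd q = f i (fst q)" using i side_sign_zero_iff by blast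
  have "side_sign k v = side_sign k q" if k: "k \<in> I" "side_sign k v \<noteq> 0" for k
  proof -
    have "k \<noteq> i" using k by (auto simp: v_def side_sign_def)
    \<comment> \<open>Both \<open>v\<close> and \<open>q\<close> are on curve \<open>i\<close>, so
      their signs at \<open>k\<close> are signs of \<open>f i - f k\<close> and depend only on the
      side of \<open>X k\<close>.\<close>
    then obtain d where d: "\<And>x. sgn (f i x - f k x) = d * sgn (x - X k)" using X k by blast
    have "X j \<noteq> X k" using k d[of "X j"] by (auto simp: v_def side_sign_def)
    then have "sgn (X j - X k) = sgn (fst q - X k)" using j k \<open>k \<noteq> i\<close> by (intro sgn_diff_nearer) auto
    then show ?thesis using d by (simp add: v_def side_sign_def qi)
  qed
  moreover have "side_sign i v = 0" by (simp add: side_sign_def v_def)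
  moreover have "side_sign j v = 0"
    using X[OF j(1,2)] by (auto simp: side_sign_def v_def dest: spec[of _ "X j"])
  ultimately show ?thesis using j by blast
qed

lemma nearest_vertex:
  assumes "i0 \<in> I" "j0 \<in> I" "i0 \<noteq> j0"
  shows "\<exists>v\<in>vertices lines. \<forall>k\<in>I. side_sign k v \<noteq> 0 \<longrightarrow> side_sign k v = side_sign k p"
proof -
  obtain i q where i: "i \<in> I" "side_sign i q = 0"
    and q: "\<forall>k\<in>I. side_sign k q \<noteq> 0 \<longrightarrow> side_sign k q = side_sign k p"
    using nearest_line[of p] assms by blast
  obtain v j where j: "j \<in> I" "j \<noteq> i" "side_sign i v = 0" "side_sign j v = 0"
    and v: "\<forall>k\<in>I. side_sign k v \<noteq> 0 \<longrightarrow> side_sign k v = side_sign k q"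
    using nearest_vertex_on_line[OF i] assms by blast
  have "v \<in> vertices lines" using i j unfolding mem_vertices by blast
  moreover have "\<forall>k\<in>I. side_sign k v \<noteq> 0 \<longrightarrow> side_sign k v = side_sign k p"
    using q v by metis
  ultimately show ?thesis by blast
qed

section \<open>The crossing of two curves and its four faces\<close>

lemma vertex_exists:
  assumes "i \<in> I" "j \<in> I" "i \<noteq> j"
  shows "\<exists>p. side_sign i p = 0 \<and> side_sign j p = 0"
proof -
  obtain x0 d where "\<forall>x. sgn (f i x - f j x) = d * sgn (x - x0)" using cross assms by blast
  then have "sgn (f i x0 - f j x0) = 0" by simp
  then have "f i x0 = f j x0" by (simp add: sgn_zero_iff)
  then show ?thesis using assms by (intro exI[of _ "(x0, f i x0)"]) (simp add: side_sign_def)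
qed

lemma vertex_unique:
  assumes "i \<in> I" "j \<in> I" "i \<noteq> j" "side_sign i p = 0" "side_sign j p = 0" "side_sign i q = 0" "side_sign j q = 0"
  shows "p = q"
proof -
  obtain x0 d where d: "d = 1 \<or> d = -1" "\<forall>x. sgn (f i x - f j x) = d * sgn (x - x0)"
    using cross assms by blast
  have *: "snd r = f i (fst r) \<and> fst r = x0" if "side_sign i r = 0" "side_sign j r = 0" for r
  proof -
    have r: "snd r = f i (fst r)" "f i (fst r) = f j (fst r)"
      using that assms side_sign_zero_iff by auto
    then have "d * sgn (fst r - x0) = 0" using d(2)[rule_format, of "fst r"] by simp
    then show ?thesis using d(1) r by (auto simp: sgn_zero_iff)
  qed
  show ?thesis using *[of p] *[of q] assms by (simp add: prod_eq_iff)
qed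

text \<open>The crossing is a limit of the cell with the altered signs, so that cell is nonempty.
  Simplicity keeps the remaining signs nonzero, which puts \<open>q\<close> in a face, the only kind
  of cell known to be realized.\<close>

lemma face_near_vertex:
  assumes simple_system and ij: "i \<in> I" "j \<in> I" "i \<noteq> j" "side_sign i p = 0" "side_sign j p = 0"
    and st: "s = 1 \<or> s = -1" "t = 1 \<or> t = -1"
  shows "\<exists>q. side_sign i q = s \<and> side_sign j q = t \<and> (\<forall>k\<in>I-{i,j}. side_sign k q = side_sign k p)
    \<and> (\<forall>k\<in>I. side_sign k q \<noteq> 0)"
proof -
  let ?\<sigma> = "(\<lambda>k. side_sign k p)(i := s, j := t)"
  have "p \<in> closure (cell I ?\<sigma>)"
  proof (rule closure_cellI[OF assms(1)])
    fix k assume "k \<in> I"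
    then show "?\<sigma> k = 0 \<or> ?\<sigma> k = 1 \<or> ?\<sigma> k = -1" using st side_sign_cases[of k p] by simp
    show "side_sign k p \<noteq> 0 \<Longrightarrow> ?\<sigma> k = side_sign k p" using ij by (cases "k = i"; cases "k = j") auto
  qed
  then have "cell I ?\<sigma> \<noteq> {}" by auto
  then obtain q where q: "\<forall>k\<in>I. side_sign k q = ?\<sigma> k" unfolding cell_def by blast
  have nz: "side_sign k p \<noteq> 0" if "k \<in> I" "k \<noteq> i" "k \<noteq> j" for k
    using that assms unfolding simple_system_def by metis
  have "side_sign i q = s" "side_sign j q = t" using q ij by auto
  moreover have "\<forall>k\<in>I-{i,j}. side_sign k q = side_sign k p" using q by simp
  moreover have "\<forall>k\<in>I. side_sign k q \<noteq> 0"
  proof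
    fix k assume "k \<in> I"
    then show "side_sign k q \<noteq> 0" using q st nz[of k] by (cases "k = i"; cases "k = j") auto
  qed
  ultimately show ?thesis by blast
qed

lemma cell_of_eq_iff: "cell_of p = cell_of q \<longleftrightarrow> (\<forall>i\<in>I. side_sign i p = side_sign i q)"
proof
  assume "cell_of p = cell_of q"
  then have "p \<in> cell_of q" using mem_cell_of[of p] by (simp only:)
  then show "\<forall>i\<in>I. side_sign i p = side_sign i q" by (simp add: cell_def)
qed (simp add: cell_def)

lemma cell_of_subset_line:
  assumes "i \<in> I"
  shows "cell_of p \<subseteq> curve_graph (f i) \<longleftrightarrow> side_sign i p = 0"
proof
  assume "cell_of p \<subseteq> curve_graph (f i)"
  then have "p \<in> curve_graph (f i)" using mem_cell_of[of p] by blast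
  then show "side_sign i p = 0" by (simp add: side_sign_zero_iff_mem[OF assms])
next
  assume p: "side_sign i p = 0"
  show "cell_of p \<subseteq> curve_graph (f i)"
  proof
    fix q assume "q \<in> cell_of p"
    then have "side_sign i q = 0" using p assms by (simp add: cell_def)
    then show "q \<in> curve_graph (f i)" using side_sign_zero_iff_mem[OF assms] by blast
  qed
qed

end

section \<open>Two systems with the same sign vectors\<close>

locale two_systems = A: pseudoline_system I f e + B: pseudoline_system I g d
  for I :: "'i set" and f e g d
begin

definition same :: "point \<Rightarrow> point \<Rightarrow> bool" where
  "same p q \<longleftrightarrow> (\<forall>i\<in>I. B.side_sign i q = A.side_sign i p)"

text \<open>A map on sets, so that no representative of a cell has to be chosen;
  \<open>transfer_cell\<close> shows that it sends a cell to the cell with the same signs.\<close>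

definition transfer :: "point set \<Rightarrow> point set" where
  "transfer S = {q. \<exists>p\<in>S. same p q}"

lemma transfer_cell: "same p q \<Longrightarrow> transfer (A.cell_of p) = B.cell_of q"
proof
  assume "same p q"
  then show "transfer (A.cell_of p) \<subseteq> B.cell_of q"
    by (auto simp: transfer_def same_def A.cell_def B.cell_def)
  show "B.cell_of q \<subseteq> transfer (A.cell_of p)"
  proof
    fix r assume "r \<in> B.cell_of q"
    then have "same p r" using \<open>same p q\<close> by (simp add: same_def B.cell_def)
    then show "r \<in> transfer (A.cell_of p)" using A.mem_cell_of unfolding transfer_def by blast
  qed
qed

text \<open>Serves edges and faces alike, since both are the cells whose signs satisfy a condition
  (\<open>\<Phi>\<close>, respectively \<open>\<Psi>\<close>).\<close>

lemma bij_transfer: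
  assumes AB: "\<And>p. \<exists>q. same p q" and BA: "\<And>q. \<exists>p. same p q"
    and iff: "\<And>p q. same p q \<Longrightarrow> \<Phi> p \<longleftrightarrow> \<Psi> q"
  shows "bij_betw transfer (A.cell_of ` {p. \<Phi> p}) (B.cell_of ` {q. \<Psi> q})"
proof -
  have "inj_on transfer (A.cell_of ` {p. \<Phi> p})"
  proof (rule inj_onI, clarify)
    fix p p' assume eq: "transfer (A.cell_of p) = transfer (A.cell_of p')"
    obtain q q' where q: "same p q" "same p' q'" using AB by blast
    then have "B.cell_of q = B.cell_of q'" using eq transfer_cell by simp
    then show "A.cell_of p = A.cell_of p'"
      using q unfolding B.cell_of_eq_iff A.cell_of_eq_iff same_def by simp
  qed
  moreover have "transfer ` A.cell_of ` {p. \<Phi> p} = B.cell_of ` {q. \<Psi> q}"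
  proof
    show "transfer ` A.cell_of ` {p. \<Phi> p} \<subseteq> B.cell_of ` {q. \<Psi> q}"
    proof clarify
      fix p assume "\<Phi> p"
      obtain q where "same p q" using AB by blast
      then show "transfer (A.cell_of p) \<in> B.cell_of ` {q. \<Psi> q}"
        using iff \<open>\<Phi> p\<close> transfer_cell by blast
    qed
    show "B.cell_of ` {q. \<Psi> q} \<subseteq> transfer ` A.cell_of ` {p. \<Phi> p}"
    proof clarify
      fix q assume "\<Psi> q"
      obtain p where p: "same p q" using BA by blast
      then have "A.cell_of p \<in> A.cell_of ` {p. \<Phi> p}" using iff \<open>\<Psi> q\<close> by blast
      then show "B.cell_of q \<in> transfer ` A.cell_of ` {p. \<Phi> p}"
        using transfer_cell[OF p] by (metis imageI)
    qed
  qed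
  ultimately show ?thesis by (simp add: bij_betw_def)
qed

lemma combinatorially_equivalent_same_signs:
  assumes simple: A.simple_system B.simple_system
    and AB: "\<And>p. \<exists>q. same p q" and BA: "\<And>q. \<exists>p. same p q"
  shows "combinatorially_equivalent A.lines B.lines"
proof -
  define fl where "fl l = curve_graph (g (the_inv_into I (\<lambda>i. curve_graph (f i)) l))" for l
  \<comment> \<open>At a vertex the choice is forced: two zero signs already determine the point, by
    \<open>vertex_unique\<close>.\<close>
  define fv where "fv p = (SOME q. same p q)" for p
  have fl: "fl (curve_graph (f i)) = curve_graph (g i)" if "i \<in> I" for i
    unfolding fl_def using the_inv_into_f_f[OF A.curve_graph_inj that] by simp
  have fv: "same p (fv p)" for p unfolding fv_def using AB by (rule someI_ex)
  have sign: "B.side_sign i (fv p) = A.side_sign i p" if "i \<in> I" for i p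
    using fv that by (simp add: same_def)
  have cell: "transfer (A.cell_of p) = B.cell_of (fv p)" for p by (intro transfer_cell fv)
  have bl: "bij_betw fl A.lines B.lines"
  proof -
    have "bij_betw (\<lambda>i. curve_graph (g i)) I B.lines" "bij_betw (\<lambda>i. curve_graph (f i)) I A.lines"
      using A.curve_graph_inj B.curve_graph_inj by (auto simp: bij_betw_def A.lines_def B.lines_def)
    then have "bij_betw ((\<lambda>i. curve_graph (g i)) \<circ> the_inv_into I (\<lambda>i. curve_graph (f i))) A.lines B.lines"
      by (intro bij_betw_trans[OF bij_betw_the_inv_into])
    moreover have "fl = (\<lambda>i. curve_graph (g i)) \<circ> the_inv_into I (\<lambda>i. curve_graph (f i))"
      by (auto simp: fl_def)
    ultimately show ?thesis by simp
  qed
  have vert: "p \<in> vertices A.lines \<longleftrightarrow> q \<in> vertices B.lines" if "same p q" for p q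
    using that unfolding A.mem_vertices B.mem_vertices same_def by auto
  have bv: "bij_betw fv (vertices A.lines) (vertices B.lines)"
  proof (rule bij_betw_imageI)
    show "inj_on fv (vertices A.lines)"
    proof (rule inj_onI)
      fix p p' assume p: "p \<in> vertices A.lines" "fv p = fv p'"
      have "A.side_sign i p = A.side_sign i p'" if "i \<in> I" for i
        using sign[OF that, of p] sign[OF that, of p'] p by simp
      moreover obtain i j where "i \<in> I" "j \<in> I" "i \<noteq> j" "A.side_sign i p = 0" "A.side_sign j p = 0"
        using p unfolding A.mem_vertices by blast
      ultimately show "p = p'" by (intro A.vertex_unique[of i j]) simp_all
    qed
    show "fv ` vertices A.lines = vertices B.lines"
    proof
      show "fv ` vertices A.lines \<subseteq> vertices B.lines" using vert fv by blast
      show "vertices B.lines \<subseteq> fv ` vertices A.lines"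
      proof
        fix q assume q: "q \<in> vertices B.lines"
        obtain p where p: "same p q" using BA by blast
        then have "B.side_sign i (fv p) = B.side_sign i q" if "i \<in> I" for i
          using sign that unfolding same_def by simp
        moreover obtain i j where "i \<in> I" "j \<in> I" "i \<noteq> j" "B.side_sign i q = 0" "B.side_sign j q = 0"
          using q unfolding B.mem_vertices by blast
        ultimately have "fv p = q" by (intro B.vertex_unique[of i j]) simp_all
        then show "q \<in> fv ` vertices A.lines" using p q vert by blast
      qed
    qed
  qed
  have be: "bij_betw transfer (edges A.lines) (edges B.lines)"
    unfolding A.edges_eq B.edges_eq by (rule bij_transfer[OF AB BA]) (auto simp: same_def)
  have bf: "bij_betw transfer (faces A.lines) (faces B.lines)"
    unfolding A.faces_eq B.faces_eq by (rule bij_transfer[OF AB BA]) (auto simp: same_def)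
  have edge: "\<exists>p. C = A.cell_of p" if "C \<in> edges A.lines" for C
    using that unfolding A.edges_eq by blast
  have face: "\<exists>p. C = A.cell_of p" if "C \<in> faces A.lines" for C
    using that unfolding A.faces_eq by blast
  have line: "\<exists>i\<in>I. l = curve_graph (f i)" if "l \<in> A.lines" for l
    using that unfolding A.lines_def by blast
  have vl: "v \<in> l \<longleftrightarrow> fv v \<in> fl l" if l: "l \<in> A.lines" for v l
  proof -
    obtain i where i: "i \<in> I" "l = curve_graph (f i)" using line[OF l] by blast
    have "v \<in> curve_graph (f i) \<longleftrightarrow> A.side_sign i v = 0" "fv v \<in> curve_graph (g i) \<longleftrightarrow> B.side_sign i (fv v) = 0"
      using A.side_sign_zero_iff_mem[OF i(1)] B.side_sign_zero_iff_mem[OF i(1)] by blast+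
    then show ?thesis using i fl[OF i(1)] sign[OF i(1)] by simp
  qed
  have el: "C \<subseteq> l \<longleftrightarrow> transfer C \<subseteq> fl l" if C: "C \<in> edges A.lines" and l: "l \<in> A.lines" for C l
  proof -
    obtain i p where i: "i \<in> I" "l = curve_graph (f i)" and p: "C = A.cell_of p"
      using line[OF l] edge[OF C] by blast
    show ?thesis
      unfolding p cell i(2) fl[OF i(1)] A.cell_of_subset_line[OF i(1)] B.cell_of_subset_line[OF i(1)] sign[OF i(1)] ..
  qed
  have vc: "v \<in> closure C \<longleftrightarrow> fv v \<in> closure (transfer C)"
    if C: "C \<in> edges A.lines \<or> C \<in> faces A.lines" for v C
  proof -
    obtain p where p: "C = A.cell_of p" using C edge face by blast
    show ?thesis
      unfolding p cell A.mem_closure_cell_of[OF simple(1)] B.mem_closure_cell_of[OF simple(2)]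
      using sign by simp
  qed
  have eF: "C \<subseteq> closure F \<longleftrightarrow> transfer C \<subseteq> closure (transfer F)"
    if C: "C \<in> edges A.lines" and F: "F \<in> faces A.lines" for C F
  proof -
    obtain p q where pq: "C = A.cell_of p" "F = A.cell_of q" using edge[OF C] face[OF F] by blast
    show ?thesis
      unfolding pq cell A.cell_of_subset_closure[OF simple(1)] B.cell_of_subset_closure[OF simple(2)]
      using sign by simp
  qed
  show ?thesis
    unfolding combinatorially_equivalent_def
  proof (intro exI conjI)
    show "bij_betw fl A.lines B.lines" by (rule bl)
    show "bij_betw fv (vertices A.lines) (vertices B.lines)" by (rule bv)
    show "bij_betw transfer (edges A.lines) (edges B.lines)" by (rule be)
    show "bij_betw transfer (faces A.lines) (faces B.lines)" by (rule bf)
    show "\<forall>v\<in>vertices A.lines. \<forall>l\<in>A.lines. v \<in> l \<longleftrightarrow> fv v \<in> fl l"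
      by (intro ballI vl)
    show "\<forall>C\<in>edges A.lines. \<forall>l\<in>A.lines. C \<subseteq> l \<longleftrightarrow> transfer C \<subseteq> fl l"
      by (intro ballI el)
    show "\<forall>v\<in>vertices A.lines. \<forall>C\<in>edges A.lines. v \<in> closure C \<longleftrightarrow> fv v \<in> closure (transfer C)"
      by (intro ballI vc disjI1)
    show "\<forall>v\<in>vertices A.lines. \<forall>F\<in>faces A.lines. v \<in> closure F \<longleftrightarrow> fv v \<in> closure (transfer F)"
      by (intro ballI vc disjI2)
    show "\<forall>C\<in>edges A.lines. \<forall>F\<in>faces A.lines. C \<subseteq> closure F \<longleftrightarrow> transfer C \<subseteq> closure (transfer F)"
      by (intro ballI eF)
  qed
qed

section \<open>Transfer of crossings and of all sign vectors\<close>

text \<open>Only connectedness of cells is used in the second system, as its simplicity is not yet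
  known.\<close>

lemma vertex_transfer:
  assumes simple: A.simple_system
    and faces: "\<And>p. \<forall>i\<in>I. A.side_sign i p \<noteq> 0 \<Longrightarrow> \<exists>q. same p q"
    and ij: "i \<in> I" "j \<in> I" "i \<noteq> j" "A.side_sign i p = 0" "A.side_sign j p = 0"
  shows "\<exists>q. same p q"
proof -
  let ?s = "\<lambda>k. A.side_sign k p"
  have corner: "\<exists>q. B.side_sign i q = s \<and> B.side_sign j q = t \<and> (\<forall>k\<in>I-{i,j}. B.side_sign k q = ?s k)"
    if st: "s = 1 \<or> s = -1" "t = 1 \<or> t = -1" for s t
  proof -
    obtain p' where "A.side_sign i p' = s" "A.side_sign j p' = t"
      "\<forall>k\<in>I-{i,j}. A.side_sign k p' = ?s k" "\<forall>k\<in>I. A.side_sign k p' \<noteq> 0"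
      using A.face_near_vertex[OF simple ij st] by blast
    moreover from this obtain q where "same p' q" using faces by blast
    ultimately have "B.side_sign i q = s" "B.side_sign j q = t" "\<forall>k\<in>I-{i,j}. B.side_sign k q = ?s k"
      using ij by (simp_all add: same_def)
    then show ?thesis by blast
  qed
  have half: "\<exists>r. B.side_sign i r = 0 \<and> B.side_sign j r = t \<and> (\<forall>k\<in>I-{i,j}. B.side_sign k r = ?s k)"
    if t: "t = 1 \<or> t = -1" for t
  proof -
    \<comment> \<open>The sign of \<open>i\<close> is left free and that of \<open>j\<close> is held
      at \<open>t\<close>; two corners lie in this connected set on opposite sides of curve
      \<open>i\<close>.\<close>
    let ?C = "B.cell (I - {i}) (?s(j := t))"
    have mem: "r \<in> ?C \<longleftrightarrow> B.side_sign j r = t \<and> (\<forall>k\<in>I-{i,j}. B.side_sign k r = ?s k)" for r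
      using ij by (auto simp: B.cell_def)
    obtain q where q: "q \<in> ?C" "B.side_sign i q = 1"
      using corner[OF disjI1[OF refl] t] unfolding mem by blast
    obtain q' where q': "q' \<in> ?C" "B.side_sign i q' = -1"
      using corner[OF disjI2[OF refl] t] unfolding mem by blast
    obtain r where "r \<in> ?C" "B.side_sign i r = 0"
      using B.side_sign_zero_between[OF B.connected_cell ij(1) q(1) q'(1) q(2) q'(2)] by blast
    then show ?thesis unfolding mem by blast
  qed
  \<comment> \<open>Since \<open>?s i = 0\<close>, this cell is a connected piece of curve
    \<open>i\<close>; the two points from \<open>half\<close> lie in it on opposite sides of curve
    \<open>j\<close>.\<close>
  let ?C = "B.cell (I - {j}) ?s"
  have mem: "r \<in> ?C \<longleftrightarrow> B.side_sign i r = 0 \<and> (\<forall>k\<in>I-{i,j}. B.side_sign k r = ?s k)" for r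
    using ij by (auto simp: B.cell_def)
  obtain q where q: "q \<in> ?C" "B.side_sign j q = 1"
    using half[OF disjI1[OF refl]] unfolding mem by blast
  obtain q' where q': "q' \<in> ?C" "B.side_sign j q' = -1"
    using half[OF disjI2[OF refl]] unfolding mem by blast
  obtain r where "r \<in> ?C" "B.side_sign j r = 0"
    using B.side_sign_zero_between[OF B.connected_cell ij(2) q(1) q'(1) q(2) q'(2)] by blast
  then have "same p r" using ij unfolding same_def B.cell_def by auto
  then show ?thesis by blast
qed

text \<open>The hypothesis goes from \<open>A\<close> to \<open>B\<close> only. The converse passes
  through vertices, because each pair of curves has exactly one crossing in either system.\<close>

lemma combinatorially_equivalent_if_faces:
  assumes simple: A.simple_system
    and faces: "\<And>p. \<forall>i\<in>I. A.side_sign i p \<noteq> 0 \<Longrightarrow> \<exists>q. same p q"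
  shows "combinatorially_equivalent A.lines B.lines"
proof -
  have vertex_B: "\<exists>p. same p q \<and> A.side_sign i p = 0 \<and> A.side_sign j p = 0"
    if ij: "i \<in> I" "j \<in> I" "i \<noteq> j" "B.side_sign i q = 0" "B.side_sign j q = 0" for i j q
  proof -
    obtain p where p: "A.side_sign i p = 0" "A.side_sign j p = 0" using A.vertex_exists ij by blast
    then obtain q' where q': "same p q'" using vertex_transfer[OF simple faces] ij by blast
    then have "q' = q" using p ij B.vertex_unique[of i j q' q] by (simp add: same_def)
    then show ?thesis using p q' by blast
  qed
  \<comment> \<open>Three concurrent curves would have the signs of a crossing in \<open>A\<close>
    on which a third curve also vanishes.\<close>
  have simple_B: B.simple_system
    unfolding B.simple_system_def
  proof (intro ballI allI impI notI, elim conjE)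
    fix i j k q
    assume *: "i \<in> I" "j \<in> I" "k \<in> I" "i \<noteq> j" "i \<noteq> k" "j \<noteq> k"
      "B.side_sign i q = 0" "B.side_sign j q = 0" "B.side_sign k q = 0"
    then obtain p where "same p q" "A.side_sign i p = 0" "A.side_sign j p = 0" using vertex_B by blast
    moreover from this have "A.side_sign k p = 0" using * by (simp add: same_def)
    ultimately show False using simple * unfolding A.simple_system_def by blast
  qed
  have "(\<forall>p. \<exists>q. same p q) \<and> (\<forall>q. \<exists>p. same p q)"
  proof (cases "\<exists>i\<in>I. \<exists>j\<in>I. i \<noteq> j")
    case True
    then obtain i0 j0 where ij0: "i0 \<in> I" "j0 \<in> I" "i0 \<noteq> j0" by blast
    have "\<exists>q. same p q" for p
    proof -
      obtain v where "v \<in> vertices A.lines"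
        and v': "\<forall>k\<in>I. A.side_sign k v \<noteq> 0 \<longrightarrow> A.side_sign k v = A.side_sign k p"
        using A.nearest_vertex[OF ij0, of p] by blast
      then obtain i j where v: "i \<in> I" "j \<in> I" "i \<noteq> j" "A.side_sign i v = 0" "A.side_sign j v = 0"
        unfolding A.mem_vertices by blast
      then obtain w where w: "same v w" using vertex_transfer[OF simple faces] by blast
      \<comment> \<open>The signs of \<open>p\<close> refine those of \<open>v\<close>, hence those
        of \<open>w\<close>, and by \<open>simple_B\<close> every refinement occurs near
        \<open>w\<close>.\<close>
      have "w \<in> closure (B.cell I (\<lambda>k. A.side_sign k p))"
        using v' w A.side_sign_cases by (intro B.closure_cellI simple_B) (auto simp: same_def)
      then have "B.cell I (\<lambda>k. A.side_sign k p) \<noteq> {}" by auto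
      then show ?thesis unfolding B.cell_def same_def by blast
    qed
    moreover have "\<exists>p. same p q" for q
    proof -
      obtain v where "v \<in> vertices B.lines"
        and v': "\<forall>k\<in>I. B.side_sign k v \<noteq> 0 \<longrightarrow> B.side_sign k v = B.side_sign k q"
        using B.nearest_vertex[OF ij0, of q] by blast
      then obtain i j where v: "i \<in> I" "j \<in> I" "i \<noteq> j" "B.side_sign i v = 0" "B.side_sign j v = 0"
        unfolding B.mem_vertices by blast
      then obtain w where w: "same w v" using vertex_B by blast
      have "w \<in> closure (A.cell I (\<lambda>k. B.side_sign k q))"
        using v' w B.side_sign_cases by (intro A.closure_cellI simple) (auto simp: same_def)
      then have "A.cell I (\<lambda>k. B.side_sign k q) \<noteq> {}" by auto
      then obtain r where "\<forall>k\<in>I. A.side_sign k r = B.side_sign k q" unfolding A.cell_def by blast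
      then have "same r q" by (simp add: same_def)
      then show ?thesis by blast
    qed
    ultimately show ?thesis by blast
  next
    case False
    \<comment> \<open>With at most one curve there are no vertices, so points of each sign are given
      directly, by moving up or down from the curve at abscissa 0.\<close>
    then have "I = {} \<or> (\<exists>i. I = {i})" by blast
    then show ?thesis
    proof
      assume "I = {}"
      then have "same p q" for p q unfolding same_def by blast
      then show ?thesis by blast
    next
      assume "\<exists>i. I = {i}"
      then obtain i where i: "I = {i}" by blast
      then have "i \<in> I" by blast
      have same_iff: "same p q \<longleftrightarrow> B.side_sign i q = A.side_sign i p" for p q
        unfolding same_def using i by blast
      have "B.side_sign i (0, g i 0 + d i * A.side_sign i p) = A.side_sign i p" for p
        using A.side_sign_cases[OF \<open>i \<in> I\<close>, of p] B.orient[OF \<open>i \<in> I\<close>]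
        by (auto simp: B.side_sign_def)
      moreover have "B.side_sign i p = A.side_sign i (0, f i 0 + e i * B.side_sign i p)" for p
        using B.side_sign_cases[OF \<open>i \<in> I\<close>, of p] A.orient[OF \<open>i \<in> I\<close>]
        by (auto simp: A.side_sign_def)
      ultimately show ?thesis unfolding same_iff by blast
    qed
  qed
  then show ?thesis using combinatorially_equivalent_same_signs[OF simple simple_B] by blast
qed

end

section \<open>From arrangements to systems\<close>

lemma crossing_sgn:
  assumes cont: "continuous_on UNIV f" "continuous_on UNIV g"
    and p: "curve_graph f \<inter> curve_graph g = {p}" and cross: "cross_at (curve_graph f) (curve_graph g) p"
  shows "\<exists>x0 d. (d = 1 \<or> d = -1) \<and> (\<forall>x. sgn (f x - g x) = d * sgn (x - x0))"
proof -
  have zero: "f x = g x \<longleftrightarrow> x = fst p" for x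
  proof
    assume "f x = g x"
    then have "(x, f x) \<in> curve_graph f \<inter> curve_graph g" by (simp add: curve_graph_iff)
    then show "x = fst p" using p by auto
  next
    assume "x = fst p"
    moreover have "p \<in> curve_graph f \<inter> curve_graph g" using p by simp
    ultimately show "f x = g x" by (simp add: curve_graph_iff)
  qed
  from cross consider
      "\<forall>\<^sub>F x in at_left (fst p). f x < g x" "\<forall>\<^sub>F x in at_right (fst p). g x < f x"
    | "\<forall>\<^sub>F x in at_left (fst p). g x < f x" "\<forall>\<^sub>F x in at_right (fst p). f x < g x"
    unfolding cross_at_def by auto
  then show ?thesis
  proof cases
    case 1
    then have "sgn (f x - g x) = sgn (x - fst p)" for x
    proof (intro sgn_crossing[of "\<lambda>x. f x - g x"])
      show "continuous_on UNIV (\<lambda>x. f x - g x)" by (intro continuous_intros cont)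
      show "f x - g x = 0 \<longleftrightarrow> x = fst p" for x using zero[of x] by simp
    qed (use 1 in simp)
    then show ?thesis by (intro exI[of _ "fst p"] exI[of _ 1]) simp
  next
    case 2
    then have "sgn (g x - f x) = sgn (x - fst p)" for x
    proof (intro sgn_crossing[of "\<lambda>x. g x - f x"])
      show "continuous_on UNIV (\<lambda>x. g x - f x)" by (intro continuous_intros cont)
      show "g x - f x = 0 \<longleftrightarrow> x = fst p" for x using zero[of x] by auto
    qed (use 2 in simp)
    then have "sgn (f x - g x) = - sgn (x - fst p)" for x
      using sgn_minus[of "g x - f x"] by simp
    then show ?thesis by (intro exI[of _ "fst p"] exI[of _ "-1"]) simp
  qed
qed

text \<open>The indexing \<open>h\<close> allows the realizing curves to be indexed by the curves of
  the original arrangement, so that two systems share one index set.\<close>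

lemma pseudoline_systemI:
  assumes L: "pseudoline_arrangement L" and bij: "bij_betw h I L"
    and h: "\<And>i. i \<in> I \<Longrightarrow> h i = curve_graph (f i)" and e: "\<And>i. i \<in> I \<Longrightarrow> e i = 1 \<or> e i = -1"
  shows "pseudoline_system I f e"
proof
  show "finite I" using L bij bij_betw_finite unfolding pseudoline_arrangement_def by blast
  have hL: "h i \<in> L" if "i \<in> I" for i using bij that by (auto simp: bij_betw_def)
  show cont: "continuous_on UNIV (f i)" if "i \<in> I" for i
    using L hL[OF that] h[OF that] unfolding pseudoline_arrangement_def pseudoline_def
    by (metis curve_graph_inject)
  show "e i = 1 \<or> e i = -1" if "i \<in> I" for i using e that .
  fix i j assume ij: "i \<in> I" "j \<in> I" "i \<noteq> j"
  then have "h i \<noteq> h j" using bij by (auto simp: bij_betw_def inj_on_def)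
  then obtain p where "h i \<inter> h j = {p}" "cross_at (h i) (h j) p"
    using L hL ij unfolding pseudoline_arrangement_def by blast
  then show "\<exists>x0 d. (d = 1 \<or> d = -1) \<and> (\<forall>x. sgn (f i x - f j x) = d * sgn (x - x0))"
    using crossing_sgn[OF cont cont] ij h by metis
qed

text \<open>One curve is itself an arrangement whose faces are its sides, so \<open>faces_eq\<close>
  applies; \<open>e\<close> is the sign of a point on the chosen side.\<close>

lemma side_orientation:
  assumes f: "continuous_on UNIV f" and s: "s \<in> sides (curve_graph f)"
  shows "\<exists>e. (e = 1 \<or> e = -1) \<and> (\<forall>p. p \<in> s \<longleftrightarrow> e * sgn (snd p - f (fst p)) = 1)"
proof -
  interpret S: pseudoline_system "{()}" "\<lambda>_. f" "\<lambda>_. 1"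
    by (simp add: pseudoline_system_def f)
  have "s \<in> faces S.lines" using s by (simp add: sides_def faces_def S.lines_def)
  then obtain q where q: "s = S.cell_of q" "S.side_sign () q \<noteq> 0" unfolding S.faces_eq by auto
  then have "S.side_sign () q = 1 \<or> S.side_sign () q = -1" using S.side_sign_cases by blast
  then show ?thesis
  proof
    assume "S.side_sign () q = 1"
    then have "p \<in> s \<longleftrightarrow> 1 * sgn (snd p - f (fst p)) = 1" for p
      unfolding q(1) S.cell_def S.side_sign_def by simp
    then show ?thesis by blast
  next
    assume "S.side_sign () q = -1"
    then have "p \<in> s \<longleftrightarrow> - 1 * sgn (snd p - f (fst p)) = 1" for p
      unfolding q(1) S.cell_def S.side_sign_def by auto
    then show ?thesis by blast
  qed
qed

lemma arrangement_orientation: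
  assumes "pseudoline_arrangement L" "\<forall>l\<in>L. s l \<in> sides l"
  shows "\<exists>f e. \<forall>l\<in>L. l = curve_graph (f l) \<and> (e l = 1 \<or> e l = -1) \<and>
    (\<forall>p. p \<in> s l \<longleftrightarrow> e l * sgn (snd p - f l (fst p)) = (1::real))"
proof -
  have "\<forall>l\<in>L. \<exists>fe. l = curve_graph (fst fe) \<and> (snd fe = 1 \<or> snd fe = -1) \<and>
    (\<forall>p. p \<in> s l \<longleftrightarrow> snd fe * sgn (snd p - fst fe (fst p)) = 1)"
  proof
    fix l assume l: "l \<in> L"
    then obtain f where f: "continuous_on UNIV f" "l = curve_graph f"
      using assms unfolding pseudoline_arrangement_def pseudoline_def by blast
    then obtain e where "e = 1 \<or> e = -1" "\<forall>p. p \<in> s l \<longleftrightarrow> e * sgn (snd p - f (fst p)) = 1"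
      using side_orientation[of f "s l"] assms l by auto
    then show "\<exists>fe. l = curve_graph (fst fe) \<and> (snd fe = 1 \<or> snd fe = -1) \<and>
        (\<forall>p. p \<in> s l \<longleftrightarrow> snd fe * sgn (snd p - fst fe (fst p)) = 1)"
      using f by (intro exI[of _ "(f, e)"]) simp
  qed
  from bchoice[OF this] obtain fe where "\<forall>l\<in>L. l = curve_graph (fst (fe l)) \<and> (snd (fe l) = 1 \<or> snd (fe l) = -1) \<and>
    (\<forall>p. p \<in> s l \<longleftrightarrow> snd (fe l) * sgn (snd p - fst (fe l) (fst p)) = 1)" by blast
  then show ?thesis
    by (intro exI[of _ "\<lambda>l. fst (fe l)"] exI[of _ "\<lambda>l. snd (fe l)"])
qed

theorem mainTheorem9:
  fixes A :: "point set set" and P :: "point set" and c :: "point set \<Rightarrow> point set"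
    and \<pi> :: "point \<Rightarrow> point" and L :: "point set set" and s :: "point set \<Rightarrow> point set"
    and b :: "point set \<Rightarrow> point set"
  assumes "simple_arrangement A"
    and "one_point_per_face P A"
    and "\<forall>l\<in>A. c l \<in> sides l"
    and "pseudohalfplane_realization P (side_hyperedges P A c) \<pi> L s b"
  shows "combinatorially_equivalent A L"
proof -
  let ?E = "side_hyperedges P A c"
  have arrA: "pseudoline_arrangement A" using assms(1) by (simp add: simple_arrangement_def)
  have arrL: "pseudoline_arrangement L" and sL: "\<forall>l\<in>L. s l \<in> sides l" and b: "bij_betw b ?E L"
    and real: "\<And>h. h \<in> ?E \<Longrightarrow> {v \<in> P. \<pi> v \<in> s (b h)} = h" and off: "\<And>v l. v \<in> P \<Longrightarrow> l \<in> L \<Longrightarrow> \<pi> v \<notin> l"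
    using assms(4) unfolding pseudohalfplane_realization_def pseudohalfplane_family_def by auto
  obtain f e where fe: "\<forall>l\<in>A. l = curve_graph (f l) \<and> (e l = 1 \<or> e l = -1) \<and>
    (\<forall>p. p \<in> c l \<longleftrightarrow> e l * sgn (snd p - f l (fst p)) = (1::real))"
    using arrangement_orientation[OF arrA assms(3)] by blast
  have fA: "curve_graph (f l) = l" and eA: "e l = 1 \<or> e l = -1" if "l \<in> A" for l
    using bspec[OF fe that] by simp_all
  interpret A: pseudoline_system A f e
    by (rule pseudoline_systemI[OF arrA bij_betw_id]) (simp_all add: fA eA)
  have A_lines: "A.lines = A" by (simp add: A.lines_def fA)
  have c: "p \<in> c l \<longleftrightarrow> A.side_sign l p = 1" if "l \<in> A" for l p
    using bspec[OF fe that] unfolding A.side_sign_def by blast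
  have on: "A.side_sign l p = 0 \<longleftrightarrow> p \<in> l" if "l \<in> A" for l p
    using that by (simp add: A.side_sign_zero_iff_mem fA)
  have simple: A.simple_system
    unfolding A.simple_system_def using assms(1) on unfolding simple_arrangement_def by blast
  have face_point: "\<exists>p\<in>P. \<forall>l\<in>A. A.side_sign l p = A.side_sign l q" if "\<forall>l\<in>A. A.side_sign l q \<noteq> 0" for q
  proof -
    have "A.cell_of q \<in> faces A" using A.faces_eq A_lines that by auto
    then obtain p where "p \<in> P" "p \<in> A.cell_of q"
      using assms(2) unfolding one_point_per_face_def by blast
    then show ?thesis by (auto simp: A.cell_def)
  qed
  have P_off: "A.side_sign l p \<noteq> 0" if "p \<in> P" "l \<in> A" for p l
  proof -
    have "p \<in> \<Union>(faces A.lines)" using assms(2) that A_lines unfolding one_point_per_face_def by auto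
    then show ?thesis using that by (auto simp: A.faces_eq A.cell_def)
  qed
  \<comment> \<open>Hyperedges form a set, so two curves might give the same one. A face at their
    crossing, on the chosen side of \<open>l\<close> only, contains a point of \<open>P\<close>
    telling them apart.\<close>
  have "inj_on (\<lambda>l. P \<inter> c l) A"
  proof (rule inj_onI, rule ccontr)
    fix l m assume lm: "l \<in> A" "m \<in> A" "P \<inter> c l = P \<inter> c m" "l \<noteq> m"
    obtain v where "A.side_sign l v = 0" "A.side_sign m v = 0" using A.vertex_exists lm by blast
    then obtain q where q: "A.side_sign l q = 1" "A.side_sign m q = -1" "\<forall>k\<in>A. A.side_sign k q \<noteq> 0"
      using A.face_near_vertex[OF simple lm(1,2,4), of v 1 "-1"] by auto
    then obtain p where "p \<in> P" "\<forall>k\<in>A. A.side_sign k p = A.side_sign k q" using face_point by blast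
    then have "A.side_sign l p = 1" "A.side_sign m p \<noteq> 1" using q lm(1,2) by simp_all
    then have "p \<in> c l" "p \<notin> c m" using c[OF lm(1), of p] c[OF lm(2), of p] by blast+
    then show False using \<open>p \<in> P\<close> lm(3) by blast
  qed
  then have "bij_betw (\<lambda>l. P \<inter> c l) A ?E" by (simp add: bij_betw_def side_hyperedges_def)
  then have h: "bij_betw (\<lambda>l. b (P \<inter> c l)) A L"
    using bij_betw_trans[OF _ b] by (simp add: comp_def)
  obtain g d where gd: "\<forall>l\<in>L. l = curve_graph (g l) \<and> (d l = 1 \<or> d l = -1) \<and>
    (\<forall>p. p \<in> s l \<longleftrightarrow> d l * sgn (snd p - g l (fst p)) = (1::real))"
    using arrangement_orientation[OF arrL sL] by blast
  \<comment> \<open>The boundary of the pseudohalfplane that realizes the hyperedge of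
    \<open>l\<close>.\<close>
  let ?h = "\<lambda>l. b (P \<inter> c l)"
  have hL: "?h l \<in> L" if "l \<in> A" for l using h that by (auto simp: bij_betw_def)
  have gL: "curve_graph (g (?h l)) = ?h l" and dL: "d (?h l) = 1 \<or> d (?h l) = -1"
    and sh: "p \<in> s (?h l) \<longleftrightarrow> d (?h l) * sgn (snd p - g (?h l) (fst p)) = 1" if "l \<in> A" for l p
    using bspec[OF gd hL[OF that]] by (simp, blast, blast)
  interpret B: pseudoline_system A "\<lambda>l. g (?h l)" "\<lambda>l. d (?h l)"
    by (rule pseudoline_systemI[OF arrL h]) (simp_all add: gL dL)
  interpret two_systems A f e "\<lambda>l. g (?h l)" "\<lambda>l. d (?h l)" ..
  have B_lines: "B.lines = L"
  proof -
    have "B.lines = ?h ` A" unfolding B.lines_def by (intro image_cong refl gL)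
    then show ?thesis using h by (simp add: bij_betw_def)
  qed
  have "same p (\<pi> p)" if p: "p \<in> P" for p
    unfolding same_def
  proof
    fix l assume l: "l \<in> A"
    have "P \<inter> c l \<in> ?E" using l by (auto simp: side_hyperedges_def)
    then have "\<pi> p \<in> s (?h l) \<longleftrightarrow> p \<in> c l" using real[of "P \<inter> c l"] p by blast
    then have "B.side_sign l (\<pi> p) = 1 \<longleftrightarrow> A.side_sign l p = 1"
      unfolding c[OF l] sh[OF l] B.side_sign_def .
    \<comment> \<open>Membership only tells whether a sign is 1; excluding 0 on both sides makes -1
      the only alternative.\<close>
    moreover have "B.side_sign l (\<pi> p) \<noteq> 0"
      using off[OF p hL[OF l]] unfolding B.side_sign_zero_iff_mem[OF l] gL[OF l] .
    ultimately show "B.side_sign l (\<pi> p) = A.side_sign l p"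
      using P_off[OF p l] A.side_sign_cases[OF l, of p] B.side_sign_cases[OF l, of "\<pi> p"] by auto
  qed
  moreover have "same p q" if "\<forall>l\<in>A. A.side_sign l r = A.side_sign l p" "same r q" for p q r
    using that by (simp add: same_def)
  ultimately have "\<exists>q. same p q" if "\<forall>l\<in>A. A.side_sign l p \<noteq> 0" for p
    using face_point[OF that] by blast
  then have "combinatorially_equivalent A.lines B.lines"
    by (intro combinatorially_equivalent_if_faces simple)
  then show ?thesis by (simp add: A_lines B_lines)
qed

end
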